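(* Let $G$ be an infinite amenable discrete group. Then $\mathrm{Th}(\ell^{1}(G),* )$ is unstable.
   Context: For a discrete group $G$, $(\ell^1(G),* )$ denotes the convolution algebra of $G$: the real Banach lattice $\ell^1(G)$ (functions $f:G\to\mathbb{R}$ with $\|f\|=\sum_{x}|f(x)|<\infty$, pointwise order) equipped with convolution $(f*g)(x)=\sum_{y\in G}f(y)g(y^{-1}x)$. It is regarded as a metric structure in continuous first-order logic in the language $\mathcal{L}_{\mathrm{cnv}}=\{+,0,\wedge,\vee,\|\cdot\|,*\}$ with metric $d(f,g)=\|f-g\|$; formally one works in the unit ball, treating $+,\wedge,\vee$ as maps from the unit ball to the ball of radius $2$ (or rescaling them by $1/2$). $\mathrm{Th}$ is the complete continuous theory. A continuous theory $T$ is unstable if there exist a model $M$ of $T$, a formula $\varphi(\bar x,\bar y)$ and parameters $(\bar a_n)_{n<\omega},(\bar b_m)_{m<\omega}$ from $M$ such that both iterated limits $\lim_{n}\lim_{m}\varphi(\bar a_n,\bar b_m)$ and $\lim_{m}\lim_{n}\varphi(\bar a_n,\bar b_m)$ exist and are different. A discrete group $G$ is amenable if there is a net $(X_i)$ of finite nonempty subsets with $\lim_i|(gX_i)\triangle X_i|/|X_i|=0$ for every $g\in G$. *)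

theory Defs
  imports "HOL-Analysis.Analysis" "HOL-Algebra.Coset"
begin

section \<open>Continuous first-order logic\<close>

text \<open>
  A signature records, besides arities, a bound on the diameter of the structures, a range for
  every predicate symbol, and moduli of uniform continuity (with respect to the maximum metric on
  tuples) for all symbols.
\<close>

record ('f, 'p) signature =
  diameter :: real
  fn_arity :: "'f \<Rightarrow> nat"
  fn_modulus :: "'f \<Rightarrow> real \<Rightarrow> real"
  pr_arity :: "'p \<Rightarrow> nat"
  pr_modulus :: "'p \<Rightarrow> real \<Rightarrow> real"
  pr_range :: "'p \<Rightarrow> real set"

datatype 'f tm = Var nat | App 'f "'f tm list"

text \<open>
  An \<open>n\<close>-ary connective is a continuous function on \<open>\<real>\<^sup>n\<close>. It is represented by a function on
  real sequences that is continuous for the product topology (continuity is part of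
  \<open>wf_fm\<close> below) and is evaluated at sequences vanishing from position \<open>n\<close> on.
\<close>

datatype ('f, 'p) fm =
    Dist "'f tm" "'f tm"
  | Pred 'p "'f tm list"
  | Conn "(nat \<Rightarrow> real) \<Rightarrow> real" "('f, 'p) fm list"
  | SupQ nat "('f, 'p) fm"
  | InfQ nat "('f, 'p) fm"

fun wf_tm :: "('f, 'p) signature \<Rightarrow> 'f tm \<Rightarrow> bool" where
  "wf_tm L (Var i) \<longleftrightarrow> True"
| "wf_tm L (App f ts) \<longleftrightarrow> length ts = fn_arity L f \<and> (\<forall>t\<in>set ts. wf_tm L t)"

fun wf_fm :: "('f, 'p) signature \<Rightarrow> ('f, 'p) fm \<Rightarrow> bool" where
  "wf_fm L (Dist s t) \<longleftrightarrow> wf_tm L s \<and> wf_tm L t"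
| "wf_fm L (Pred p ts) \<longleftrightarrow> length ts = pr_arity L p \<and> (\<forall>t\<in>set ts. wf_tm L t)"
| "wf_fm L (Conn u \<phi>s) \<longleftrightarrow> continuous_on UNIV u \<and> (\<forall>\<phi>\<in>set \<phi>s. wf_fm L \<phi>)"
| "wf_fm L (SupQ i \<phi>) \<longleftrightarrow> wf_fm L \<phi>"
| "wf_fm L (InfQ i \<phi>) \<longleftrightarrow> wf_fm L \<phi>"

fun tm_vars :: "'f tm \<Rightarrow> nat set" where
  "tm_vars (Var i) = {i}"
| "tm_vars (App f ts) = (\<Union>t\<in>set ts. tm_vars t)"

fun free_vars :: "('f, 'p) fm \<Rightarrow> nat set" where
  "free_vars (Dist s t) = tm_vars s \<union> tm_vars t"
| "free_vars (Pred p ts) = (\<Union>t\<in>set ts. tm_vars t)"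
| "free_vars (Conn u \<phi>s) = (\<Union>\<phi>\<in>set \<phi>s. free_vars \<phi>)"
| "free_vars (SupQ i \<phi>) = free_vars \<phi> - {i}"
| "free_vars (InfQ i \<phi>) = free_vars \<phi> - {i}"

record ('f, 'p, 'a) interp =
  univ :: "'a set"
  metric :: "'a \<Rightarrow> 'a \<Rightarrow> real"
  fn_int :: "'f \<Rightarrow> 'a list \<Rightarrow> 'a"
  pr_int :: "'p \<Rightarrow> 'a list \<Rightarrow> real"

definition tuples :: "('f, 'p, 'a) interp \<Rightarrow> nat \<Rightarrow> 'a list set" where
  "tuples M n = {as. length as = n \<and> set as \<subseteq> univ M}"

definition metric_structure :: "('f, 'p) signature \<Rightarrow> ('f, 'p, 'a) interp \<Rightarrow> bool" where
  "metric_structure L M \<longleftrightarrow>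
     univ M \<noteq> {} \<and>
     Metric_space (univ M) (metric M) \<and>
     Metric_space.mcomplete (univ M) (metric M) \<and>
     (\<forall>a\<in>univ M. \<forall>b\<in>univ M. metric M a b \<le> diameter L) \<and>
     (\<forall>f. \<forall>as\<in>tuples M (fn_arity L f). fn_int M f as \<in> univ M) \<and>
     (\<forall>f. \<forall>\<epsilon>>0. \<forall>as\<in>tuples M (fn_arity L f). \<forall>bs\<in>tuples M (fn_arity L f).
        (\<forall>i<fn_arity L f. metric M (as ! i) (bs ! i) < fn_modulus L f \<epsilon>) \<longrightarrow>
        metric M (fn_int M f as) (fn_int M f bs) \<le> \<epsilon>) \<and>
     (\<forall>p. \<forall>as\<in>tuples M (pr_arity L p). pr_int M p as \<in> pr_range L p) \<and>
     (\<forall>p. \<forall>\<epsilon>>0. \<forall>as\<in>tuples M (pr_arity L p). \<forall>bs\<in>tuples M (pr_arity L p).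
        (\<forall>i<pr_arity L p. metric M (as ! i) (bs ! i) < pr_modulus L p \<epsilon>) \<longrightarrow>
        \<bar>pr_int M p as - pr_int M p bs\<bar> \<le> \<epsilon>)"

fun tm_val :: "('f, 'p, 'a) interp \<Rightarrow> (nat \<Rightarrow> 'a) \<Rightarrow> 'f tm \<Rightarrow> 'a" where
  "tm_val M e (Var i) = e i"
| "tm_val M e (App f ts) = fn_int M f (map (tm_val M e) ts)"

fun fm_val :: "('f, 'p, 'a) interp \<Rightarrow> (nat \<Rightarrow> 'a) \<Rightarrow> ('f, 'p) fm \<Rightarrow> real" where
  "fm_val M e (Dist s t) = metric M (tm_val M e s) (tm_val M e t)"
| "fm_val M e (Pred p ts) = pr_int M p (map (tm_val M e) ts)"
| "fm_val M e (Conn u \<phi>s) =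
     u (\<lambda>i. if i < length \<phi>s then map (fm_val M e) \<phi>s ! i else 0)"
| "fm_val M e (SupQ i \<phi>) = (SUP a\<in>univ M. fm_val M (e(i := a)) \<phi>)"
| "fm_val M e (InfQ i \<phi>) = (INF a\<in>univ M. fm_val M (e(i := a)) \<phi>)"

text \<open>
  A theory is a set of sentences; a sentence \<open>\<phi>\<close> in it stands for the closed condition \<open>\<phi> = 0\<close>.
  As \<open>\<bar>\<phi> - r\<bar>\<close> is a sentence whenever \<open>\<phi>\<close> is one, \<open>Th L M\<close> determines the values of all
  sentences in \<open>M\<close>.
\<close>

definition sentence :: "('f, 'p) signature \<Rightarrow> ('f, 'p) fm \<Rightarrow> bool" where
  "sentence L \<phi> \<longleftrightarrow> wf_fm L \<phi> \<and> free_vars \<phi> = {}"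

definition satisfies :: "('f, 'p, 'a) interp \<Rightarrow> ('f, 'p) fm \<Rightarrow> bool" where
  "satisfies M \<phi> \<longleftrightarrow> (\<forall>e. range e \<subseteq> univ M \<longrightarrow> fm_val M e \<phi> = 0)"

definition Th :: "('f, 'p) signature \<Rightarrow> ('f, 'p, 'a) interp \<Rightarrow> ('f, 'p) fm set" where
  "Th L M = {\<phi>. sentence L \<phi> \<and> satisfies M \<phi>}"

definition model_of :: "('f, 'p) signature \<Rightarrow> ('f, 'p) fm set \<Rightarrow> ('f, 'p, 'a) interp \<Rightarrow> bool" where
  "model_of L T M \<longleftrightarrow> metric_structure L M \<and> (\<forall>\<phi>\<in>T. satisfies M \<phi>)"

definition iterated_limit :: "(nat \<Rightarrow> nat \<Rightarrow> real) \<Rightarrow> real \<Rightarrow> bool" where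
  "iterated_limit F r \<longleftrightarrow> (\<exists>h. (\<forall>n. (\<lambda>m. F n m) \<longlonglongrightarrow> h n) \<and> h \<longlonglongrightarrow> r)"

text \<open>
  In \<open>\<phi>(x,y)\<close> the tuple \<open>x\<close> consists of the variables \<open>0,\<dots>,k-1\<close> and the tuple \<open>y\<close> of the
  variables \<open>k,\<dots>,k+l-1\<close>. The type argument fixes the type from which the points of the model are
  drawn. For a countable signature every type with at least continuum many elements gives the same
  notion: a witness of instability passes to a separable elementary substructure containing the
  parameters, and a separable complete metric space has at most continuum many points.
\<close>

definition unstable :: "'a itself \<Rightarrow> ('f, 'p) signature \<Rightarrow> ('f, 'p) fm set \<Rightarrow> bool" where
  "unstable (U :: 'a itself) L T \<longleftrightarrow>
     (\<exists>(M :: ('f, 'p, 'a) interp) \<phi> k l a b.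
        model_of L T M \<and>
        wf_fm L \<phi> \<and> free_vars \<phi> \<subseteq> {..<k + l} \<and>
        (\<forall>n. a n \<in> tuples M k) \<and> (\<forall>m. b m \<in> tuples M l) \<and>
        (\<exists>r s. iterated_limit (\<lambda>n m. fm_val M (\<lambda>i. (a n @ b m) ! i) \<phi>) r \<and>
               iterated_limit (\<lambda>m n. fm_val M (\<lambda>i. (a n @ b m) ! i) \<phi>) s \<and>
               r \<noteq> s))"

section \<open>The convolution algebra of a discrete group\<close>

text \<open>Functions on the group are represented by functions vanishing outside the carrier.\<close>

definition ell1 :: "('g, 'b) monoid_scheme \<Rightarrow> ('g \<Rightarrow> real) set" where
  "ell1 G = {f. (\<lambda>x. \<bar>f x\<bar>) summable_on carrier G \<and> (\<forall>x. x \<notin> carrier G \<longrightarrow> f x = 0)}"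

definition ell1_norm :: "('g, 'b) monoid_scheme \<Rightarrow> ('g \<Rightarrow> real) \<Rightarrow> real" where
  "ell1_norm G f = (\<Sum>\<^sub>\<infinity>x\<in>carrier G. \<bar>f x\<bar>)"

definition convolution ::
  "('g, 'b) monoid_scheme \<Rightarrow> ('g \<Rightarrow> real) \<Rightarrow> ('g \<Rightarrow> real) \<Rightarrow> 'g \<Rightarrow> real" where
  "convolution G f g x =
     (if x \<in> carrier G
      then (\<Sum>\<^sub>\<infinity>y\<in>carrier G. f y * g (inv\<^bsub>G\<^esub> y \<otimes>\<^bsub>G\<^esub> x)) else 0)"

text \<open>
  The structure lives on the unit ball of \<open>\<ell>\<^sup>1(G)\<close>; addition and the lattice operations are rescaled
  by \<open>1/2\<close>, so that they map the unit ball into itself. With this normalisation they are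
  1-Lipschitz for the maximum metric on pairs, while convolution is 2-Lipschitz.
\<close>

datatype cnv_fn = Cnv_Zero | Cnv_Plus | Cnv_Meet | Cnv_Join | Cnv_Conv
datatype cnv_pr = Cnv_Norm

fun cnv_arity :: "cnv_fn \<Rightarrow> nat" where
  "cnv_arity Cnv_Zero = 0"
| "cnv_arity Cnv_Plus = 2"
| "cnv_arity Cnv_Meet = 2"
| "cnv_arity Cnv_Join = 2"
| "cnv_arity Cnv_Conv = 2"

definition L_cnv :: "(cnv_fn, cnv_pr) signature" where
  "L_cnv = \<lparr>
     diameter = 2,
     fn_arity = cnv_arity,
     fn_modulus = (\<lambda>f \<epsilon>. if f = Cnv_Conv then \<epsilon> / 2 else \<epsilon>),
     pr_arity = (\<lambda>_. 1),
     pr_modulus = (\<lambda>_ \<epsilon>. \<epsilon>),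
     pr_range = (\<lambda>_. {0..1})\<rparr>"

fun cnv_fn_int ::
  "('g, 'b) monoid_scheme \<Rightarrow> cnv_fn \<Rightarrow> ('g \<Rightarrow> real) list \<Rightarrow> 'g \<Rightarrow> real" where
  "cnv_fn_int G Cnv_Zero [] = (\<lambda>x. 0)"
| "cnv_fn_int G Cnv_Plus [f, g] = (\<lambda>x. (f x + g x) / 2)"
| "cnv_fn_int G Cnv_Meet [f, g] = (\<lambda>x. min (f x) (g x) / 2)"
| "cnv_fn_int G Cnv_Join [f, g] = (\<lambda>x. max (f x) (g x) / 2)"
| "cnv_fn_int G Cnv_Conv [f, g] = convolution G f g"

fun cnv_pr_int :: "('g, 'b) monoid_scheme \<Rightarrow> cnv_pr \<Rightarrow> ('g \<Rightarrow> real) list \<Rightarrow> real" where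
  "cnv_pr_int G Cnv_Norm [f] = ell1_norm G f"

definition ell1_cnv :: "('g, 'b) monoid_scheme \<Rightarrow> (cnv_fn, cnv_pr, 'g \<Rightarrow> real) interp" where
  "ell1_cnv G = \<lparr>
     univ = {f \<in> ell1 G. ell1_norm G f \<le> 1},
     metric = (\<lambda>f g. ell1_norm G (\<lambda>x. f x - g x)),
     fn_int = cnv_fn_int G,
     pr_int = cnv_pr_int G\<rparr>"

section \<open>Amenability\<close>

text \<open>
  A net \<open>(X\<^sub>i)\<close> of finite nonempty sets is given by the filter generated by its tails; conversely
  every proper filter on sets arises from a net in this way.
\<close>

definition amenable :: "('g, 'b) monoid_scheme \<Rightarrow> bool" where
  "amenable G \<longleftrightarrow>
     (\<exists>F :: 'g set filter. F \<noteq> bot \<and>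
        (\<forall>\<^sub>F X in F. finite X \<and> X \<noteq> {} \<and> X \<subseteq> carrier G) \<and>
        (\<forall>g\<in>carrier G.
           ((\<lambda>X. real (card (sym_diff (g <#\<^bsub>G\<^esub> X) X)) / real (card X)) \<longlongrightarrow> 0) F))"

end

theory Submission
  imports Defs
begin

text \<open>
  The structure \<open>\<ell>\<^sup>1(G)\<close> itself has the order property. Let \<open>f\<^sub>n\<close> be the normalised indicator
  function of a finite set \<open>X\<^sub>n\<close>, where \<open>|X\<^sub>n| \<rightarrow> \<infinity>\<close> and \<open>X\<^sub>m\<close> is almost invariant under left
  translation by the elements of \<open>X\<^sub>n\<close> for \<open>n < m\<close>. For fixed \<open>n\<close> and \<open>m \<rightarrow> \<infinity>\<close> the
  convolution \<open>f\<^sub>n * f\<^sub>m\<close> approaches \<open>f\<^sub>m\<close>, so \<open>\<parallel>(f\<^sub>n * f\<^sub>m) \<and> f\<^sub>m\<parallel> \<rightarrow> 1\<close>. For fixed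
  \<open>m\<close> and \<open>n \<rightarrow> \<infinity>\<close> the bound \<open>f\<^sub>n * f\<^sub>m \<le> 1 / |X\<^sub>n|\<close> gives
  \<open>\<parallel>(f\<^sub>n * f\<^sub>m) \<and> f\<^sub>m\<parallel> \<le> |X\<^sub>m| / |X\<^sub>n| \<rightarrow> 0\<close>.
\<close>

section \<open>The Banach lattice of summable functions\<close>

text \<open>The terms \<open>\<bar>f x\<bar>\<close> are nonnegative, so bounded finite sums force
  summability and the infinite sum is their supremum. Norm estimates below are thereby reduced to
  finite sums.\<close>

lemma ell1I:
  assumes "\<And>x. x \<notin> carrier G \<Longrightarrow> f x = 0"
    and "\<And>F. finite F \<Longrightarrow> F \<subseteq> carrier G \<Longrightarrow> (\<Sum>x\<in>F. \<bar>f x\<bar>) \<le> c"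
  shows "f \<in> ell1 G" and "ell1_norm G f \<le> c"
proof -
  have sm: "(\<lambda>x. \<bar>f x\<bar>) summable_on carrier G"
    by (rule nonneg_bdd_above_summable_on) (auto intro!: bdd_aboveI[of _ c] assms(2))
  then show "f \<in> ell1 G" by (simp add: ell1_def assms(1))
  show "ell1_norm G f \<le> c"
    unfolding ell1_norm_def by (rule infsum_le_finite_sums[OF sm]) (rule assms(2))
qed

lemma ell1_outside: "f \<in> ell1 G \<Longrightarrow> x \<notin> carrier G \<Longrightarrow> f x = 0"
  by (simp add: ell1_def)

lemma ell1_summable: "f \<in> ell1 G \<Longrightarrow> (\<lambda>x. \<bar>f x\<bar>) summable_on carrier G"
  by (simp add: ell1_def)

lemma sum_le_ell1_norm:
  assumes "f \<in> ell1 G" "finite F" "F \<subseteq> carrier G"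
  shows "(\<Sum>x\<in>F. \<bar>f x\<bar>) \<le> ell1_norm G f"
  unfolding ell1_norm_def
  by (rule finite_sum_le_infsum) (use assms in \<open>auto simp: ell1_summable\<close>)

lemma ell1_norm_nonneg: "0 \<le> ell1_norm G f"
  unfolding ell1_norm_def by (rule infsum_nonneg) simp

lemma abs_le_ell1_norm:
  assumes "f \<in> ell1 G"
  shows "\<bar>f x\<bar> \<le> ell1_norm G f"
proof (cases "x \<in> carrier G")
  case True
  then show ?thesis using sum_le_ell1_norm[OF assms, of "{x}"] by simp
qed (use assms in \<open>simp add: ell1_outside ell1_norm_nonneg\<close>)

text \<open>A common source for closure and Lipschitz estimates: the pointwise bound is summed over
  finite sets and passed to the norm through \<open>ell1I\<close>. Outside the carrier both
  majorants vanish, hence so does \<open>h\<close>.\<close>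

lemma ell1_dominated:
  assumes "f \<in> ell1 G" "g \<in> ell1 G" "0 \<le> s" "0 \<le> t"
    and "\<And>x. \<bar>h x\<bar> \<le> s * \<bar>f x\<bar> + t * \<bar>g x\<bar>"
  shows "h \<in> ell1 G" and "ell1_norm G h \<le> s * ell1_norm G f + t * ell1_norm G g"
proof -
  have out: "h x = 0" if "x \<notin> carrier G" for x
    using assms(5)[of x] that assms(1,2) by (simp add: ell1_outside)
  have bd: "(\<Sum>x\<in>F. \<bar>h x\<bar>) \<le> s * ell1_norm G f + t * ell1_norm G g"
    if "finite F" "F \<subseteq> carrier G" for F
  proof -
    have "(\<Sum>x\<in>F. \<bar>h x\<bar>) \<le> (\<Sum>x\<in>F. s * \<bar>f x\<bar> + t * \<bar>g x\<bar>)"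
      by (rule sum_mono) (rule assms(5))
    also have "\<dots> = s * (\<Sum>x\<in>F. \<bar>f x\<bar>) + t * (\<Sum>x\<in>F. \<bar>g x\<bar>)"
      by (simp add: sum.distrib sum_distrib_left)
    also have "\<dots> \<le> s * ell1_norm G f + t * ell1_norm G g"
      using that assms by (intro add_mono mult_left_mono sum_le_ell1_norm) auto
    finally show ?thesis .
  qed
  show "h \<in> ell1 G" "ell1_norm G h \<le> s * ell1_norm G f + t * ell1_norm G g"
    using ell1I[of G h, OF out bd] by auto
qed

lemma ell1_zero: "(\<lambda>x. 0) \<in> ell1 G" "ell1_norm G (\<lambda>x. 0) = 0"
  by (simp_all add: ell1_def ell1_norm_def)

lemma ell1_diff:
  assumes "f \<in> ell1 G" "g \<in> ell1 G"
  shows "(\<lambda>x. f x - g x) \<in> ell1 G"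
  by (rule ell1_dominated[OF assms, of 1 1]) auto

lemma ell1_norm_diff_triangle:
  assumes "f \<in> ell1 G" "g \<in> ell1 G" "h \<in> ell1 G"
  shows "ell1_norm G (\<lambda>x. f x - h x) \<le>
    ell1_norm G (\<lambda>x. f x - g x) + ell1_norm G (\<lambda>x. g x - h x)"
  using ell1_dominated(2)[OF ell1_diff[OF assms(1,2)] ell1_diff[OF assms(2,3)],
      of 1 1 "\<lambda>x. f x - h x"]
  by simp

lemma ell1_norm_diff_commute: "ell1_norm G (\<lambda>x. f x - g x) = ell1_norm G (\<lambda>x. g x - f x)"
  by (simp add: ell1_norm_def abs_minus_commute)

lemma abs_ell1_norm_diff_le:
  assumes "f \<in> ell1 G" "g \<in> ell1 G"
  shows "\<bar>ell1_norm G f - ell1_norm G g\<bar> \<le> ell1_norm G (\<lambda>x. f x - g x)"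
  using ell1_norm_diff_triangle[OF assms ell1_zero(1)]
    ell1_norm_diff_triangle[OF assms(2,1) ell1_zero(1)]
    ell1_norm_diff_commute[of G f g]
  by simp

lemma ell1_norm_eq_0D:
  assumes "f \<in> ell1 G" "ell1_norm G f = 0"
  shows "f x = 0"
  using abs_le_ell1_norm[OF assms(1), of x] assms(2) by simp

lemma ell1_finite_support:
  assumes "finite X" "X \<subseteq> carrier G" "\<And>x. x \<notin> X \<Longrightarrow> f x = 0"
  shows "f \<in> ell1 G" and "ell1_norm G f = (\<Sum>x\<in>X. \<bar>f x\<bar>)"
proof -
  have "((\<lambda>x. \<bar>f x\<bar>) has_sum (\<Sum>x\<in>X. \<bar>f x\<bar>)) (carrier G)"
    using has_sum_finite[OF assms(1), of "\<lambda>x. \<bar>f x\<bar>"]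
    by (rule has_sum_cong_neutral[THEN iffD1, rotated -1]) (use assms in auto)
  then show "f \<in> ell1 G" "ell1_norm G f = (\<Sum>x\<in>X. \<bar>f x\<bar>)"
    unfolding ell1_def ell1_norm_def using assms
    by (auto simp: infsumI has_sum_imp_summable)
qed

section \<open>The unit ball as a complete metric space\<close>

abbreviation ell1_ball :: "('g, 'b) monoid_scheme \<Rightarrow> ('g \<Rightarrow> real) set" where
  "ell1_ball G \<equiv> {f \<in> ell1 G. ell1_norm G f \<le> 1}"

abbreviation ell1_dist ::
  "('g, 'b) monoid_scheme \<Rightarrow> ('g \<Rightarrow> real) \<Rightarrow> ('g \<Rightarrow> real) \<Rightarrow> real" where
  "ell1_dist G \<equiv> \<lambda>f g. ell1_norm G (\<lambda>x. f x - g x)"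

lemma Metric_space_ell1: "Metric_space (ell1_ball G) (ell1_dist G)"
proof
  fix f g h :: "'a \<Rightarrow> real"
  show "0 \<le> ell1_dist G f g" by (rule ell1_norm_nonneg)
  show "ell1_dist G f g = ell1_dist G g f" by (rule ell1_norm_diff_commute)
  assume fg: "f \<in> ell1_ball G" "g \<in> ell1_ball G"
  show "ell1_dist G f g = 0 \<longleftrightarrow> f = g"
  proof
    assume "ell1_dist G f g = 0"
    then have "f x - g x = 0" for x
      using ell1_norm_eq_0D[OF ell1_diff, of f G g x] fg by simp
    then show "f = g" by (auto simp: fun_eq_iff)
  qed (simp add: ell1_zero)
  assume "h \<in> ell1_ball G"
  then show "ell1_dist G f h \<le> ell1_dist G f g + ell1_dist G g h"
    using fg by (intro ell1_norm_diff_triangle) auto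
qed

text \<open>Cauchy sequences converge pointwise, since evaluation is 1-Lipschitz. Both the bound 1
  and the Cauchy estimate then survive the limit on each finite set, which is all that
  \<open>ell1I\<close> asks for.\<close>

lemma mcomplete_ell1: "Metric_space.mcomplete (ell1_ball G) (ell1_dist G)"
proof -
  interpret Metric_space "ell1_ball G" "ell1_dist G" by (rule Metric_space_ell1)
  show ?thesis
    unfolding mcomplete_def
  proof (intro allI impI)
    fix \<sigma> assume \<sigma>: "MCauchy \<sigma>"
    have ball: "\<sigma> n \<in> ell1 G" "ell1_norm G (\<sigma> n) \<le> 1" for n
      using \<sigma> by (auto simp: MCauchy_def)
    have cau: "\<exists>N. \<forall>n\<ge>N. \<forall>n'\<ge>N. ell1_dist G (\<sigma> n) (\<sigma> n') < \<epsilon>" if "\<epsilon> > 0" for \<epsilon>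
      using \<sigma>[unfolded MCauchy_def, THEN conjunct2, rule_format, OF that] by blast
    have "Cauchy (\<lambda>n. \<sigma> n x)" for x
    proof (rule metric_CauchyI)
      fix e :: real assume "e > 0"
      then obtain N where "\<forall>n\<ge>N. \<forall>n'\<ge>N. ell1_dist G (\<sigma> n) (\<sigma> n') < e" using cau by blast
      moreover have "dist (\<sigma> m x) (\<sigma> n x) \<le> ell1_dist G (\<sigma> m) (\<sigma> n)" for m n
        using abs_le_ell1_norm[OF ell1_diff[OF ball(1)[of m] ball(1)[of n]], of x] by (simp add: dist_real_def)
      ultimately show "\<exists>M. \<forall>m\<ge>M. \<forall>n\<ge>M. dist (\<sigma> m x) (\<sigma> n x) < e"
        by (meson le_less_trans)
    qed
    then have "\<forall>x. \<exists>l. (\<lambda>n. \<sigma> n x) \<longlonglongrightarrow> l"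
      by (auto simp: Cauchy_convergent_iff convergent_def)
    then obtain f where f: "\<And>x. (\<lambda>n. \<sigma> n x) \<longlonglongrightarrow> f x" by metis
    have out: "f x = 0" if "x \<notin> carrier G" for x
      using f[of x] ell1_outside[OF ball(1) that] by (simp add: LIMSEQ_const_iff)
    have bd: "(\<Sum>x\<in>F. \<bar>f x\<bar>) \<le> 1" if "finite F" "F \<subseteq> carrier G" for F
    proof (rule LIMSEQ_le_const2)
      show "(\<lambda>n. \<Sum>x\<in>F. \<bar>\<sigma> n x\<bar>) \<longlonglongrightarrow> (\<Sum>x\<in>F. \<bar>f x\<bar>)"
        by (intro tendsto_sum tendsto_rabs f)
      show "\<exists>N. \<forall>n\<ge>N. (\<Sum>x\<in>F. \<bar>\<sigma> n x\<bar>) \<le> 1"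
        using sum_le_ell1_norm[OF ball(1) that] ball(2) by (meson order_trans)
    qed
    have fball: "f \<in> ell1_ball G"
      using ell1I[of G f 1, OF out bd] by simp
    have "\<exists>N. \<forall>n\<ge>N. \<sigma> n \<in> ell1_ball G \<and> ell1_dist G (\<sigma> n) f < \<epsilon>" if pos: "\<epsilon> > 0" for \<epsilon>
    proof -
      \<comment> \<open>Limits keep only weak inequalities, so \<open>\<epsilon> / 2\<close> is
        aimed at in order to end with a strict one.\<close>
      obtain N where N: "\<And>n n'. n \<ge> N \<Longrightarrow> n' \<ge> N \<Longrightarrow> ell1_dist G (\<sigma> n) (\<sigma> n') < \<epsilon> / 2"
        using cau[OF half_gt_zero[OF pos]] by blast
      have "ell1_dist G (\<sigma> n) f \<le> \<epsilon> / 2" if "n \<ge> N" for n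
      proof (rule ell1I)
        fix F assume F: "finite F" "F \<subseteq> carrier G"
        show "(\<Sum>x\<in>F. \<bar>\<sigma> n x - f x\<bar>) \<le> \<epsilon> / 2"
        proof (rule LIMSEQ_le_const2)
          show "(\<lambda>k. \<Sum>x\<in>F. \<bar>\<sigma> n x - \<sigma> k x\<bar>) \<longlonglongrightarrow> (\<Sum>x\<in>F. \<bar>\<sigma> n x - f x\<bar>)"
            by (intro tendsto_sum tendsto_rabs tendsto_diff tendsto_const f)
          have "(\<Sum>x\<in>F. \<bar>\<sigma> n x - \<sigma> k x\<bar>) \<le> \<epsilon> / 2" if "k \<ge> N" for k
            using sum_le_ell1_norm[OF ell1_diff[OF ball(1)[of n] ball(1)[of k]] F]
              N[OF \<open>n \<ge> N\<close> that] by linarith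
          then show "\<exists>M. \<forall>k\<ge>M. (\<Sum>x\<in>F. \<bar>\<sigma> n x - \<sigma> k x\<bar>) \<le> \<epsilon> / 2" by blast
        qed
      qed (use out ell1_outside[OF ball(1)] in simp)
      then have "\<forall>n\<ge>N. \<sigma> n \<in> ell1_ball G \<and> ell1_dist G (\<sigma> n) f < \<epsilon>"
        using ball pos by fastforce
      then show ?thesis ..
    qed
    then show "\<exists>f. limitin mtopology \<sigma> f sequentially"
      using fball unfolding limit_metric_sequentially by blast
  qed
qed

section \<open>Convolution\<close>

text \<open>Since norms are controlled on finite sets, the Tonelli step for convolutions only has to
  exchange a finite sum with an infinite one.\<close>

lemma infsum_sum:
  fixes f :: "'a \<Rightarrow> 'b \<Rightarrow> 'c::{topological_comm_monoid_add, t2_space}"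
  assumes "finite F" "\<And>x. x \<in> F \<Longrightarrow> f x summable_on A"
  shows "(\<lambda>y. \<Sum>x\<in>F. f x y) summable_on A"
    and "(\<Sum>\<^sub>\<infinity>y\<in>A. \<Sum>x\<in>F. f x y) = (\<Sum>x\<in>F. \<Sum>\<^sub>\<infinity>y\<in>A. f x y)"
proof -
  have "((\<lambda>y. \<Sum>x\<in>F. f x y) has_sum (\<Sum>x\<in>F. \<Sum>\<^sub>\<infinity>y\<in>A. f x y)) A"
    using assms by (induction F) (auto intro!: has_sum_add)
  then show "(\<lambda>y. \<Sum>x\<in>F. f x y) summable_on A"
    "(\<Sum>\<^sub>\<infinity>y\<in>A. \<Sum>x\<in>F. f x y) = (\<Sum>x\<in>F. \<Sum>\<^sub>\<infinity>y\<in>A. f x y)"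
    by (auto simp: has_sum_imp_summable infsumI)
qed

lemma infsum_diff:
  fixes f g :: "'a \<Rightarrow> 'b::{topological_ab_group_add, t2_space}"
  assumes "f summable_on A" "g summable_on A"
  shows "(\<Sum>\<^sub>\<infinity>x\<in>A. f x - g x) = infsum f A - infsum g A"
  using infsum_add[of f A "\<lambda>x. - g x"] assms by (simp add: summable_on_uminus infsum_uminus)

context group
begin

text \<open>The second factor is bounded by its norm, which leaves a multiple of the summable
  function \<open>\<bar>f y\<bar>\<close> as majorant.\<close>

lemma convolution_summable:
  assumes "f \<in> ell1 G" "g \<in> ell1 G"
  shows "(\<lambda>y. \<bar>f y * g (inv y \<otimes> x)\<bar>) summable_on carrier G"
proof (rule summable_on_comparison_test)
  show "(\<lambda>y. \<bar>f y\<bar> * ell1_norm G g) summable_on carrier G"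
    using ell1_summable[OF assms(1)] by (rule summable_on_cmult_left)
qed (use abs_le_ell1_norm[OF assms(2)] in \<open>auto simp: abs_mult intro!: mult_left_mono\<close>)

lemma convolution_summable':
  assumes "f \<in> ell1 G" "g \<in> ell1 G"
  shows "(\<lambda>y. f y * g (inv y \<otimes> x)) summable_on carrier G"
  by (rule abs_summable_summable) (simp add: convolution_summable[OF assms])

text \<open>On a finite set \<open>F\<close> of outputs the sums are exchanged; for fixed
  \<open>y\<close> the inner sum of \<open>g\<close> then runs over a left translate of
  \<open>F\<close>, so it is at most the norm of \<open>g\<close>.\<close>

lemma convolution_ell1:
  assumes f: "f \<in> ell1 G" and g: "g \<in> ell1 G"
  shows "convolution G f g \<in> ell1 G"
    and "ell1_norm G (convolution G f g) \<le> ell1_norm G f * ell1_norm G g"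
proof -
  have out: "convolution G f g x = 0" if "x \<notin> carrier G" for x
    using that by (simp add: convolution_def)
  have bd: "(\<Sum>x\<in>F. \<bar>convolution G f g x\<bar>) \<le> ell1_norm G f * ell1_norm G g"
    if F: "finite F" "F \<subseteq> carrier G" for F
  proof -
    have "(\<Sum>x\<in>F. \<bar>convolution G f g x\<bar>)
        \<le> (\<Sum>x\<in>F. \<Sum>\<^sub>\<infinity>y\<in>carrier G. \<bar>f y * g (inv y \<otimes> x)\<bar>)"
    proof (rule sum_mono)
      fix x assume "x \<in> F"
      then have "x \<in> carrier G" using F by auto
      then show "\<bar>convolution G f g x\<bar> \<le> (\<Sum>\<^sub>\<infinity>y\<in>carrier G. \<bar>f y * g (inv y \<otimes> x)\<bar>)"
        using norm_infsum_bound[of "\<lambda>y. f y * g (inv y \<otimes> x)" "carrier G"]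
          convolution_summable[OF f g, of x]
        by (simp add: convolution_def)
    qed
    also have "\<dots> = (\<Sum>\<^sub>\<infinity>y\<in>carrier G. \<Sum>x\<in>F. \<bar>f y * g (inv y \<otimes> x)\<bar>)"
      by (rule infsum_sum(2)[symmetric]) (use F convolution_summable[OF f g] in auto)
    also have "\<dots> \<le> (\<Sum>\<^sub>\<infinity>y\<in>carrier G. \<bar>f y\<bar> * ell1_norm G g)"
    proof (rule infsum_mono)
      show "(\<lambda>y. \<Sum>x\<in>F. \<bar>f y * g (inv y \<otimes> x)\<bar>) summable_on carrier G"
        by (intro infsum_sum(1) F convolution_summable[OF f g])
      show "(\<lambda>y. \<bar>f y\<bar> * ell1_norm G g) summable_on carrier G"
        using ell1_summable[OF f] by (rule summable_on_cmult_left)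
      fix y assume y: "y \<in> carrier G"
      have inj: "inj_on (\<lambda>x. inv y \<otimes> x) F"
        using F y by (auto simp: inj_on_def subset_iff)
      have "(\<Sum>x\<in>F. \<bar>g (inv y \<otimes> x)\<bar>) = (\<Sum>z\<in>(\<lambda>x. inv y \<otimes> x) ` F. \<bar>g z\<bar>)"
        by (simp add: sum.reindex[OF inj])
      also have "\<dots> \<le> ell1_norm G g"
        using F y by (intro sum_le_ell1_norm g) auto
      finally show "(\<Sum>x\<in>F. \<bar>f y * g (inv y \<otimes> x)\<bar>) \<le> \<bar>f y\<bar> * ell1_norm G g"
        by (simp add: abs_mult mult_left_mono flip: sum_distrib_left)
    qed
    also have "\<dots> = ell1_norm G f * ell1_norm G g"
      unfolding ell1_norm_def[of G f] by (rule infsum_cmult_left) (use ell1_summable[OF f] in auto)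
    finally show ?thesis .
  qed
  show "convolution G f g \<in> ell1 G"
    "ell1_norm G (convolution G f g) \<le> ell1_norm G f * ell1_norm G g"
    using ell1I[of G "convolution G f g", OF out bd] by auto
qed

text \<open>Bilinearity in telescoped form, changing one factor at a time; summability of each
  series justifies splitting the infinite sums.\<close>

lemma convolution_diff:
  assumes "f \<in> ell1 G" "g \<in> ell1 G" "f' \<in> ell1 G" "g' \<in> ell1 G"
  shows "convolution G f g x - convolution G f' g' x =
    convolution G (\<lambda>z. f z - f' z) g x + convolution G f' (\<lambda>z. g z - g' z) x"
proof (cases "x \<in> carrier G")
  case True
  have "convolution G (\<lambda>z. f z - f' z) g x = convolution G f g x - convolution G f' g x"
    using True infsum_diff[OF convolution_summable'[OF assms(1,2), of x]
        convolution_summable'[OF assms(3,2), of x]]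
    by (simp add: convolution_def left_diff_distrib)
  moreover have "convolution G f' (\<lambda>z. g z - g' z) x = convolution G f' g x - convolution G f' g' x"
    using True infsum_diff[OF convolution_summable'[OF assms(3,2), of x]
        convolution_summable'[OF assms(3,4), of x]]
    by (simp add: convolution_def right_diff_distrib)
  ultimately show ?thesis by simp
qed (simp add: convolution_def)

text \<open>Each term of the telescoped difference has one factor in the unit ball, so
  submultiplicativity leaves one distance per term. The total is at most twice the larger distance,
  which accounts for the modulus \<open>\<epsilon> / 2\<close> of \<open>Cnv_Conv\<close>.\<close>

lemma ell1_dist_convolution_le:
  assumes f: "f \<in> ell1_ball G" and g: "g \<in> ell1_ball G"
    and f': "f' \<in> ell1_ball G" and g': "g' \<in> ell1_ball G"
  shows "ell1_dist G (convolution G f g) (convolution G f' g') \<le> ell1_dist G f f' + ell1_dist G g g'"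
proof -
  let ?u = "convolution G (\<lambda>z. f z - f' z) g" and ?v = "convolution G f' (\<lambda>z. g z - g' z)"
  have d: "(\<lambda>z. f z - f' z) \<in> ell1 G" "(\<lambda>z. g z - g' z) \<in> ell1 G"
    using assms by (auto intro: ell1_diff)
  have "ell1_dist G (convolution G f g) (convolution G f' g') \<le> 1 * ell1_norm G ?u + 1 * ell1_norm G ?v"
  proof (rule ell1_dominated)
    show "?u \<in> ell1 G" "?v \<in> ell1 G" using d g f' by (auto intro: convolution_ell1)
  qed (use assms in \<open>auto simp: convolution_diff intro: order_trans[OF abs_triangle_ineq]\<close>)
  also have "ell1_norm G ?u \<le> ell1_dist G f f' * 1"
    using g by (intro order_trans[OF convolution_ell1(2)[OF d(1)]] mult_left_mono)
      (auto simp: ell1_norm_nonneg)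
  also have "ell1_norm G ?v \<le> 1 * ell1_dist G g g'"
    using f' by (intro order_trans[OF convolution_ell1(2)[OF _ d(2)]] mult_right_mono)
      (auto simp: ell1_norm_nonneg)
  finally show ?thesis by simp
qed

end

section \<open>The unit ball as a metric structure for \<open>L_cnv\<close>\<close>

lemma ell1_cnv_simps [simp]:
  "univ (ell1_cnv G) = ell1_ball G"
  "metric (ell1_cnv G) = ell1_dist G"
  "fn_int (ell1_cnv G) = cnv_fn_int G"
  "pr_int (ell1_cnv G) = cnv_pr_int G"
  by (simp_all add: ell1_cnv_def)

lemma L_cnv_simps [simp]:
  "diameter L_cnv = 2"
  "fn_arity L_cnv = cnv_arity"
  "fn_modulus L_cnv f \<epsilon> = (if f = Cnv_Conv then \<epsilon> / 2 else \<epsilon>)"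
  "pr_arity L_cnv p = 1"
  "pr_modulus L_cnv p \<epsilon> = \<epsilon>"
  "pr_range L_cnv p = {0..1}"
  by (simp_all add: L_cnv_def)

lemma tuples_ell1_0: "as \<in> tuples (ell1_cnv G) 0 \<longleftrightarrow> as = []"
  by (auto simp: tuples_def)

lemma tuples_ell1_1: "as \<in> tuples (ell1_cnv G) (Suc 0) \<longleftrightarrow> (\<exists>f\<in>ell1_ball G. as = [f])"
  by (auto simp: tuples_def length_Suc_conv)

lemma tuples_ell1_2:
  "as \<in> tuples (ell1_cnv G) 2 \<longleftrightarrow> (\<exists>f\<in>ell1_ball G. \<exists>g\<in>ell1_ball G. as = [f, g])"
  by (auto simp: tuples_def length_Suc_conv numeral_2_eq_2)

text \<open>The instance fitted to the rescaling by \<open>1/2\<close>: an average of two norms at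
  most 1, or of two distances below \<open>\<epsilon>\<close>, obeys the same bound. It serves
  addition, meet and join alike.\<close>

lemma ell1_half_dominated:
  assumes "f \<in> ell1 G" "g \<in> ell1 G" "\<And>x. \<bar>h x\<bar> \<le> (\<bar>f x\<bar> + \<bar>g x\<bar>) / 2"
  shows "h \<in> ell1 G" and "ell1_norm G h \<le> (ell1_norm G f + ell1_norm G g) / 2"
  using ell1_dominated[OF assms(1,2), of "1/2" "1/2" h] assms(3) by (simp_all add: add_divide_distrib)

lemma cnv_half_ops_closed:
  assumes "f \<in> ell1_ball G" "g \<in> ell1_ball G"
  shows "(\<lambda>x. (f x + g x) / 2) \<in> ell1_ball G"
    and "(\<lambda>x. min (f x) (g x) / 2) \<in> ell1_ball G"
    and "(\<lambda>x. max (f x) (g x) / 2) \<in> ell1_ball G"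
proof -
  have "h \<in> ell1_ball G" if "\<And>x. \<bar>h x\<bar> \<le> (\<bar>f x\<bar> + \<bar>g x\<bar>) / 2" for h
    using ell1_half_dominated[of f G g h] assms that by simp
  then show "(\<lambda>x. (f x + g x) / 2) \<in> ell1_ball G"
    "(\<lambda>x. min (f x) (g x) / 2) \<in> ell1_ball G" "(\<lambda>x. max (f x) (g x) / 2) \<in> ell1_ball G"
    by auto
qed

context group
begin

lemma cnv_fn_int_closed:
  assumes "as \<in> tuples (ell1_cnv G) (cnv_arity F)"
  shows "cnv_fn_int G F as \<in> ell1_ball G"
proof (cases F)
  case Cnv_Zero
  then show ?thesis using assms by (simp add: tuples_ell1_0 ell1_zero)
next
  case Cnv_Conv
  then obtain f g where "f \<in> ell1_ball G" "g \<in> ell1_ball G" "as = [f, g]"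
    using assms by (auto simp: tuples_ell1_2)
  moreover from this have "ell1_norm G f * ell1_norm G g \<le> 1"
    by (intro mult_le_one) (auto simp: ell1_norm_nonneg)
  ultimately show ?thesis
    using Cnv_Conv convolution_ell1[of f g] by simp
qed (use assms in \<open>auto simp: tuples_ell1_2 cnv_half_ops_closed[simplified]\<close>)

lemma cnv_fn_int_Lipschitz:
  assumes "as \<in> tuples (ell1_cnv G) (cnv_arity F)" "bs \<in> tuples (ell1_cnv G) (cnv_arity F)"
    and "0 < \<epsilon>"
    and "\<And>i. i < cnv_arity F \<Longrightarrow>
      ell1_dist G (as ! i) (bs ! i) < (if F = Cnv_Conv then \<epsilon> / 2 else \<epsilon>)"
  shows "ell1_dist G (cnv_fn_int G F as) (cnv_fn_int G F bs) \<le> \<epsilon>"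
proof (cases "F = Cnv_Zero")
  case True
  then show ?thesis using assms by (simp add: tuples_ell1_0 ell1_zero)
next
  case False
  then have two: "cnv_arity F = 2" by (cases F) auto
  then obtain f g f' g' where fg: "as = [f, g]" "bs = [f', g']"
    "f \<in> ell1_ball G" "g \<in> ell1_ball G" "f' \<in> ell1_ball G" "g' \<in> ell1_ball G"
    using assms(1,2) by (auto simp: tuples_ell1_2)
  have d: "(\<lambda>x. f x - f' x) \<in> ell1 G" "(\<lambda>x. g x - g' x) \<in> ell1 G"
    using fg by (auto intro: ell1_diff)
  show ?thesis
  proof (cases "F = Cnv_Conv")
    case True
    then show ?thesis
      using ell1_dist_convolution_le[of f g f' g'] fg assms(4)[of 0] assms(4)[of 1] by simp
  next
    case nconv: False
    have "ell1_dist G (cnv_fn_int G F as) (cnv_fn_int G F bs)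
        \<le> (ell1_dist G f f' + ell1_dist G g g') / 2"
    proof (rule ell1_half_dominated(2)[OF d])
      fix x
      \<comment> \<open>Sum, minimum and maximum of two reals move by at most the total displacement
        of their arguments.\<close>
      show "\<bar>cnv_fn_int G F as x - cnv_fn_int G F bs x\<bar> \<le> (\<bar>f x - f' x\<bar> + \<bar>g x - g' x\<bar>) / 2"
        using False nconv fg(1,2) by (cases F) (auto simp: min_def max_def abs_if field_simps)
    qed
    then show ?thesis
      using nconv fg two assms(4)[of 0] assms(4)[of 1] by simp
  qed
qed

text \<open>Instability asks for a model of the theory; this makes \<open>ell1_cnv G\<close>
  available as a model of its own theory.\<close>

lemma metric_structure_ell1_cnv: "metric_structure L_cnv (ell1_cnv G)"
  unfolding metric_structure_def ell1_cnv_simps L_cnv_simps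
proof (intro conjI allI impI ballI)
  show "ell1_ball G \<noteq> {}" using ell1_zero[of G] by force
  show "Metric_space (ell1_ball G) (ell1_dist G)" by (rule Metric_space_ell1)
  show "Metric_space.mcomplete (ell1_ball G) (ell1_dist G)" by (rule mcomplete_ell1)
next
  fix f g assume "f \<in> ell1_ball G" "g \<in> ell1_ball G"
  then show "ell1_dist G f g \<le> 2"
    using ell1_dominated(2)[of f G g 1 1 "\<lambda>x. f x - g x"] by (auto simp: abs_triangle_ineq4)
next
  fix F as assume "as \<in> tuples (ell1_cnv G) (cnv_arity F)"
  then show "cnv_fn_int G F as \<in> ell1_ball G" by (rule cnv_fn_int_closed)
next
  fix F as bs and \<epsilon> :: real
  assume "0 < \<epsilon>" "as \<in> tuples (ell1_cnv G) (cnv_arity F)" "bs \<in> tuples (ell1_cnv G) (cnv_arity F)"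
    "\<forall>i<cnv_arity F. ell1_dist G (as ! i) (bs ! i) < (if F = Cnv_Conv then \<epsilon> / 2 else \<epsilon>)"
  then show "ell1_dist G (cnv_fn_int G F as) (cnv_fn_int G F bs) \<le> \<epsilon>"
    by (intro cnv_fn_int_Lipschitz) auto
next
  fix p as assume "as \<in> tuples (ell1_cnv G) 1"
  then show "cnv_pr_int G p as \<in> {0..1}"
    by (cases p) (auto simp: tuples_ell1_1 ell1_norm_nonneg)
next
  fix p as bs and \<epsilon> :: real
  assume "0 < \<epsilon>" "as \<in> tuples (ell1_cnv G) 1" "bs \<in> tuples (ell1_cnv G) 1"
    "\<forall>i<1. ell1_dist G (as ! i) (bs ! i) < \<epsilon>"
  then show "\<bar>cnv_pr_int G p as - cnv_pr_int G p bs\<bar> \<le> \<epsilon>"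
    by (cases p) (auto simp: tuples_ell1_1 intro: order_trans[OF abs_ell1_norm_diff_le less_imp_le])
qed

section \<open>Normalised indicator functions\<close>

text \<open>Turns the translate inside a convolution into a coset: evaluating an indicator of
  \<open>Y\<close> at \<open>inv y \<otimes> x\<close> tests membership of \<open>x\<close> in the
  translate of \<open>Y\<close> that amenability controls.\<close>

lemma mem_l_coset_iff:
  assumes "y \<in> carrier G" "Y \<subseteq> carrier G" "x \<in> carrier G"
  shows "x \<in> y <#\<^bsub>G\<^esub> Y \<longleftrightarrow> inv y \<otimes> x \<in> Y"
proof
  assume "inv y \<otimes> x \<in> Y"
  moreover have "x = y \<otimes> (inv y \<otimes> x)" using assms by (simp flip: m_assoc)
  ultimately show "x \<in> y <#\<^bsub>G\<^esub> Y" unfolding l_coset_def by blast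
next
  assume "x \<in> y <#\<^bsub>G\<^esub> Y"
  then obtain z where "z \<in> Y" "x = y \<otimes> z" unfolding l_coset_def by blast
  moreover have "z \<in> carrier G" using \<open>z \<in> Y\<close> assms by auto
  ultimately show "inv y \<otimes> x \<in> Y" using assms by (simp flip: m_assoc)
qed

end

text \<open>For finite nonempty \<open>X\<close>, the density of the uniform probability measure on
  \<open>X\<close>.\<close>

definition normalized_indicator :: "'g set \<Rightarrow> 'g \<Rightarrow> real" where
  "normalized_indicator X x = (if x \<in> X then 1 / real (card X) else 0)"

lemma normalized_indicator_ell1:
  assumes "finite X" "X \<noteq> {}" "X \<subseteq> carrier G"
  shows "normalized_indicator X \<in> ell1 G" and "ell1_norm G (normalized_indicator X) = 1"
  using ell1_finite_support[OF assms(1,3), of "normalized_indicator X"] assms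
  by (auto simp: normalized_indicator_def)

context group
begin

text \<open>The density vanishes off \<open>X\<close>, so the series collapses to the average of the
  left translates of \<open>g\<close> over \<open>X\<close>; both estimates on the convolution start
  from this form.\<close>

lemma convolution_normalized_indicator:
  assumes "finite X" "X \<subseteq> carrier G" "x \<in> carrier G"
  shows "convolution G (normalized_indicator X) g x = (\<Sum>y\<in>X. g (inv y \<otimes> x)) / real (card X)"
proof -
  have "(\<Sum>\<^sub>\<infinity>y\<in>carrier G. normalized_indicator X y * g (inv y \<otimes> x))
      = (\<Sum>\<^sub>\<infinity>y\<in>X. g (inv y \<otimes> x) / real (card X))"
    by (rule infsum_cong_neutral) (use assms in \<open>auto simp: normalized_indicator_def\<close>)
  then show ?thesis using assms by (simp add: convolution_def sum_divide_distrib)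
qed

text \<open>For fixed \<open>x\<close> the points \<open>inv y \<otimes> x\<close> with
  \<open>y\<close> in \<open>X\<close> are distinct, so the density of \<open>Y\<close> sums to at
  most its total mass 1 over them. The upper bound is uniform in \<open>Y\<close>; it drives the
  iterated limit with value 0.\<close>

lemma convolution_normalized_indicator_bounds:
  assumes X: "finite X" "X \<subseteq> carrier G" and Y: "finite Y"
  shows "0 \<le> convolution G (normalized_indicator X) (normalized_indicator Y) x"
    and "convolution G (normalized_indicator X) (normalized_indicator Y) x \<le> 1 / real (card X)"
proof -
  have "0 \<le> convolution G (normalized_indicator X) (normalized_indicator Y) x \<and>
    convolution G (normalized_indicator X) (normalized_indicator Y) x \<le> 1 / real (card X)"
  proof (cases "x \<in> carrier G")
    case True
    have inj: "inj_on (\<lambda>y. inv y \<otimes> x) X"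
      using X True by (auto simp: inj_on_def subset_iff dest: inv_inj[THEN inj_onD])
    have "(\<Sum>y\<in>X. normalized_indicator Y (inv y \<otimes> x))
        = (\<Sum>z\<in>(\<lambda>y. inv y \<otimes> x) ` X. normalized_indicator Y z)"
      by (simp add: sum.reindex[OF inj])
    also have "\<dots> = real (card ((\<lambda>y. inv y \<otimes> x) ` X \<inter> Y)) / real (card Y)"
      using X by (simp add: normalized_indicator_def sum.If_cases Int_def)
    \<comment> \<open>Division by zero yields 0, so an empty \<open>Y\<close> is covered.\<close>
    also have "\<dots> \<le> 1"
      using Y by (auto simp: divide_le_eq_1 card_gt_0_iff intro!: card_mono)
    finally show ?thesis
      using X True by (auto simp: convolution_normalized_indicator normalized_indicator_def
          intro!: divide_right_mono divide_nonneg_nonneg sum_nonneg)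
  qed (simp add: convolution_def)
  then show "0 \<le> convolution G (normalized_indicator X) (normalized_indicator Y) x"
    "convolution G (normalized_indicator X) (normalized_indicator Y) x \<le> 1 / real (card X)"
    by auto
qed

text \<open>The difference is the average over \<open>y\<close> in \<open>X\<close> of translate
  minus original. Each such difference has norm \<open>card (sym_diff (y <# Y) Y) / card Y\<close>,
  at most \<open>\<delta>\<close>, and the triangle inequality passes this bound to the
  average.\<close>

lemma ell1_dist_convolution_normalized_indicator:
  assumes X: "finite X" "X \<noteq> {}" "X \<subseteq> carrier G" and Y: "finite Y" "Y \<noteq> {}" "Y \<subseteq> carrier G"
    and \<delta>: "\<And>y. y \<in> X \<Longrightarrow> real (card (sym_diff (y <#\<^bsub>G\<^esub> Y) Y)) \<le> \<delta> * real (card Y)"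
  shows "ell1_dist G (convolution G (normalized_indicator X) (normalized_indicator Y))
    (normalized_indicator Y) \<le> \<delta>"
proof (rule ell1I)
  fix x assume "x \<notin> carrier G"
  then show "convolution G (normalized_indicator X) (normalized_indicator Y) x
      - normalized_indicator Y x = 0"
    using Y by (auto simp: convolution_def normalized_indicator_def)
next
  fix F assume F: "finite F" "F \<subseteq> carrier G"
  let ?Y = "normalized_indicator Y"
  have cX: "real (card X) > 0" and cY: "real (card Y) > 0" using X Y by (auto simp: card_gt_0_iff)
  have "(\<Sum>x\<in>F. \<bar>convolution G (normalized_indicator X) ?Y x - ?Y x\<bar>)
      \<le> (\<Sum>x\<in>F. \<Sum>y\<in>X. \<bar>?Y (inv y \<otimes> x) - ?Y x\<bar> / real (card X))"
  proof (rule sum_mono)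
    fix x assume "x \<in> F"
    then have "convolution G (normalized_indicator X) ?Y x - ?Y x
        = (\<Sum>y\<in>X. (?Y (inv y \<otimes> x) - ?Y x) / real (card X))"
      using F X cX by (subst convolution_normalized_indicator)
        (auto simp: sum_subtractf field_simps simp flip: sum_divide_distrib)
    also have "\<bar>\<dots>\<bar> \<le> (\<Sum>y\<in>X. \<bar>(?Y (inv y \<otimes> x) - ?Y x) / real (card X)\<bar>)" by (rule sum_abs)
    finally show "\<bar>convolution G (normalized_indicator X) ?Y x - ?Y x\<bar>
        \<le> (\<Sum>y\<in>X. \<bar>?Y (inv y \<otimes> x) - ?Y x\<bar> / real (card X))" by simp
  qed
  also have "\<dots> = (\<Sum>y\<in>X. (\<Sum>x\<in>F. \<bar>?Y (inv y \<otimes> x) - ?Y x\<bar>) / real (card X))"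
    by (subst sum.swap) (simp add: sum_divide_distrib)
  also have "\<dots> \<le> (\<Sum>y\<in>X. \<delta> / real (card X))"
  proof (intro sum_mono divide_right_mono)
    fix y assume y: "y \<in> X"
    let ?D = "sym_diff (y <#\<^bsub>G\<^esub> Y) Y"
    have "finite ?D" using Y by (auto simp: l_coset_def)
    \<comment> \<open>By \<open>mem_l_coset_iff\<close> the two values differ, by exactly
      \<open>1 / card Y\<close>, just when \<open>x\<close> lies in one of \<open>y <# Y\<close> and
      \<open>Y\<close> but not in the other.\<close>
    have "(\<Sum>x\<in>F. \<bar>?Y (inv y \<otimes> x) - ?Y x\<bar>) = (\<Sum>x\<in>F. if x \<in> ?D then 1 / real (card Y) else 0)"
      using y X Y F
      by (intro sum.cong refl) (auto simp: normalized_indicator_def subset_iff mem_l_coset_iff)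
    also have "\<dots> = real (card (F \<inter> ?D)) / real (card Y)"
      using F by (simp add: sum.If_cases Int_def)
    also have "\<dots> \<le> real (card ?D) / real (card Y)"
      using \<open>finite ?D\<close> by (intro divide_right_mono) (auto intro!: card_mono)
    also have "\<dots> \<le> \<delta>" using \<delta>[OF y] cY by (simp add: divide_le_eq)
    finally show "(\<Sum>x\<in>F. \<bar>?Y (inv y \<otimes> x) - ?Y x\<bar>) \<le> \<delta>" .
  qed simp
  also have "\<dots> = \<delta>" using cX by simp
  finally show "(\<Sum>x\<in>F. \<bar>convolution G (normalized_indicator X) ?Y x - ?Y x\<bar>) \<le> \<delta>" .
qed

section \<open>Almost invariant finite sets\<close>

text \<open>Amenability yields almost invariance but no lower bound on the size of \<open>X\<close>.
  The infinite carrier forces the size: \<open>N\<close> group elements \<open>H\<close> are added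
  to \<open>K\<close>, and sufficiently good invariance under them makes \<open>X\<close> at least
  as large as \<open>H\<close>.\<close>

lemma almost_invariant_set_exists:
  assumes "infinite (carrier G)" "amenable G" "finite K" "K \<subseteq> carrier G" "0 < \<epsilon>"
  obtains X where "finite X" "X \<noteq> {}" "X \<subseteq> carrier G" "N \<le> card X"
    "\<And>g. g \<in> K \<Longrightarrow> real (card (sym_diff (g <#\<^bsub>G\<^esub> X) X)) \<le> \<epsilon> * real (card X)"
proof -
  obtain H where H: "finite H" "card H = N" "H \<subseteq> carrier G"
    using infinite_arbitrarily_large[OF assms(1)] by blast
  obtain F :: "'a set filter" where F: "F \<noteq> bot"
    "\<forall>\<^sub>F X in F. finite X \<and> X \<noteq> {} \<and> X \<subseteq> carrier G"
    "\<And>g. g \<in> carrier G \<Longrightarrow>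
      ((\<lambda>X. real (card (sym_diff (g <#\<^bsub>G\<^esub> X) X)) / real (card X)) \<longlongrightarrow> 0) F"
    using assms(2) unfolding amenable_def by blast
  \<comment> \<open>The bound \<open>1 / (real N + 1)\<close> is chosen so that a set with fewer
    than \<open>N\<close> elements would have symmetric differences of cardinality below 1, hence
    empty.\<close>
  define \<delta> where "\<delta> = min \<epsilon> (1 / (real N + 1))"
  have "\<delta> > 0" using assms(5) by (simp add: \<delta>_def)
  have "\<forall>\<^sub>F X in F. \<forall>g\<in>K \<union> H. real (card (sym_diff (g <#\<^bsub>G\<^esub> X) X)) / real (card X) < \<delta>"
    using assms H by (intro eventually_ball_finite ballI order_tendstoD(2)[OF F(3)] \<open>\<delta> > 0\<close>) auto
  then have "\<forall>\<^sub>F X in F. (finite X \<and> X \<noteq> {} \<and> X \<subseteq> carrier G) \<and>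
      (\<forall>g\<in>K \<union> H. real (card (sym_diff (g <#\<^bsub>G\<^esub> X) X)) / real (card X) < \<delta>)"
    using F(2) by (rule eventually_conj[rotated])
  from eventually_happens'[OF F(1) this]
  obtain X where X: "finite X" "X \<noteq> {}" "X \<subseteq> carrier G"
    "\<forall>g\<in>K \<union> H. real (card (sym_diff (g <#\<^bsub>G\<^esub> X) X)) / real (card X) < \<delta>"
    by (elim exE conjE) (rule that)
  have cX: "real (card X) > 0" using X by (simp add: card_gt_0_iff)
  have less: "real (card (sym_diff (g <#\<^bsub>G\<^esub> X) X)) < \<delta> * real (card X)" if "g \<in> K \<union> H" for g
    using bspec[OF X(4) that] cX by (simp add: divide_less_eq)
  have "N \<le> card X"
    \<comment> \<open>If \<open>card X < N\<close>, the symmetric differences for \<open>H\<close> have fewer than one element, so \<open>H \<otimes> x \<subseteq> X\<close>.\<close>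
  proof (rule ccontr)
    assume "\<not> N \<le> card X"
    then have "\<delta> * real (card X) \<le> 1 / (real N + 1) * (real N + 1)"
      using \<open>\<delta> > 0\<close> by (intro mult_mono) (auto simp: \<delta>_def)
    then have small: "\<delta> * real (card X) \<le> 1" by simp
    obtain x where x: "x \<in> X" using X by blast
    have "h \<otimes> x \<in> X" if "h \<in> H" for h
    proof -
      have "finite (sym_diff (h <#\<^bsub>G\<^esub> X) X)" using X by (auto simp: l_coset_def)
      moreover have "card (sym_diff (h <#\<^bsub>G\<^esub> X) X) = 0"
        using less[of h] that small by simp
      ultimately have "h <#\<^bsub>G\<^esub> X \<subseteq> X" by simp
      then show ?thesis using x by (auto simp: l_coset_def)
    qed
    moreover have "inj_on (\<lambda>h. h \<otimes> x) H"
      using H X x by (auto simp: inj_on_def subset_iff)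
    ultimately have "card H \<le> card X"
      using X by (intro card_inj_on_le) auto
    with \<open>\<not> N \<le> card X\<close> H show False by simp
  qed
  moreover have "\<delta> * real (card X) \<le> \<epsilon> * real (card X)"
    by (intro mult_right_mono) (auto simp: \<delta>_def)
  ultimately show thesis
    using less by (intro that[OF X(1-3)]) (auto intro: order_trans[OF less_imp_le])
qed

text \<open>Built recursively, the next set being almost invariant under everything chosen so far.
  The errors tend to 0 and the sizes to infinity, as the two iterated limits require.\<close>

lemma almost_invariant_sequence_exists:
  assumes "infinite (carrier G)" "amenable G"
  obtains X where "\<And>n. finite (X n)" "\<And>n. X n \<noteq> {}" "\<And>n. X n \<subseteq> carrier G"
    "\<And>n. n \<le> card (X n)"
    "\<And>n m g. n \<le> m \<Longrightarrow> g \<in> X n \<Longrightarrow>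
      real (card (sym_diff (g <#\<^bsub>G\<^esub> X (Suc m)) (X (Suc m)))) \<le> 1 / real (Suc m) * real (card (X (Suc m)))"
proof -
  \<comment> \<open>Dependent choice relates consecutive states only, so a state
    \<open>(K, X)\<close> carries its history: \<open>X\<close> is the current set and
    \<open>K\<close> a finite set that absorbs every set chosen so far.\<close>
  define P where "P n s \<longleftrightarrow> (case s of (K, X) \<Rightarrow>
    finite K \<and> K \<subseteq> carrier G \<and> X \<subseteq> K \<and> X \<noteq> {} \<and> n \<le> card X)" for n and s :: "'a set \<times> 'a set"
  define Q where "Q n s s' \<longleftrightarrow> fst s \<subseteq> fst s' \<and> (\<forall>g\<in>fst s.
    real (card (sym_diff (g <#\<^bsub>G\<^esub> snd s') (snd s'))) \<le> 1 / real (Suc n) * real (card (snd s')))"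
    for n and s s' :: "'a set \<times> 'a set"
  have "\<exists>s. \<forall>n. P n (s n) \<and> Q n (s n) (s (Suc n))"
  proof (rule dependent_nat_choice)
    show "\<exists>s. P 0 s" by (rule exI[of _ "({\<one>}, {\<one>})"]) (simp add: P_def)
  next
    fix s n assume s: "P n s"
    obtain K Y where "s = (K, Y)" by force
    with s have K: "finite K" "K \<subseteq> carrier G" by (auto simp: P_def)
    obtain X where X: "finite X" "X \<noteq> {}" "X \<subseteq> carrier G" "Suc n \<le> card X"
      "\<And>g. g \<in> K \<Longrightarrow> real (card (sym_diff (g <#\<^bsub>G\<^esub> X) X)) \<le> 1 / real (Suc n) * real (card X)"
      using almost_invariant_set_exists[OF assms K, of "1 / real (Suc n)" "Suc n"] by auto
    show "\<exists>s'. P (Suc n) s' \<and> Q n s s'"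
      by (rule exI[of _ "(K \<union> X, X)"]) (use K X \<open>s = (K, Y)\<close> in \<open>auto simp: P_def Q_def\<close>)
  qed
  then obtain s where s: "\<And>n. P n (s n)" "\<And>n. Q n (s n) (s (Suc n))" by blast
  \<comment> \<open>The stored sets grow, so invariance under \<open>fst (s m)\<close> covers every
    \<open>snd (s n)\<close> with \<open>n \<le> m\<close>.\<close>
  have mono: "fst (s n) \<subseteq> fst (s m)" if "n \<le> m" for n m
    using lift_Suc_mono_le[of "\<lambda>n. fst (s n)", OF _ that] s(2) unfolding Q_def by blast
  have sub: "snd (s n) \<subseteq> fst (s n)" "fst (s n) \<subseteq> carrier G" "finite (fst (s n))"
    "snd (s n) \<noteq> {}" "n \<le> card (snd (s n))" for n
    using s(1)[of n] by (auto simp: P_def split: prod.splits)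
  show thesis
  proof (rule that[of "\<lambda>n. snd (s n)"])
    fix n m g assume "n \<le> m" "g \<in> snd (s n)"
    then have "g \<in> fst (s m)" using mono sub by blast
    then show "real (card (sym_diff (g <#\<^bsub>G\<^esub> snd (s (Suc m))) (snd (s (Suc m)))))
        \<le> 1 / real (Suc m) * real (card (snd (s (Suc m))))"
      using s(2)[of m] unfolding Q_def by (elim conjE) (rule bspec)
  qed (use sub finite_subset[OF sub(1,3)] in auto)
qed

end

section \<open>The unstable formula\<close>

text \<open>Measures how much of the second variable survives left convolution by the first. The
  factor \<open>1/2\<close> built into \<open>Cnv_Meet\<close> makes the limits \<open>1/2\<close>
  and 0 instead of 1 and 0.\<close>

definition meet_formula :: "(cnv_fn, cnv_pr) fm" where
  "meet_formula = Pred Cnv_Norm [App Cnv_Meet [App Cnv_Conv [Var 0, Var 1], Var 1]]"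

lemma fm_val_meet_formula:
  "fm_val (ell1_cnv G) (\<lambda>i. ([f] @ [g]) ! i) meet_formula =
    ell1_norm G (\<lambda>x. min (convolution G f g x) (g x) / 2)"
  by (simp add: meet_formula_def)

context group
begin

text \<open>When the convolution is close to the density of \<open>Y\<close>, its meet with that
  density is nearly the density itself, whose half has norm \<open>1/2\<close>; the norm is
  1-Lipschitz.\<close>

lemma meet_value_almost_invariant:
  assumes X: "finite X" "X \<noteq> {}" "X \<subseteq> carrier G" and Y: "finite Y" "Y \<noteq> {}" "Y \<subseteq> carrier G"
    and \<delta>: "\<And>y. y \<in> X \<Longrightarrow> real (card (sym_diff (y <#\<^bsub>G\<^esub> Y) Y)) \<le> \<delta> * real (card Y)"
  shows "\<bar>ell1_norm G (\<lambda>x. min (convolution G (normalized_indicator X) (normalized_indicator Y) x)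
    (normalized_indicator Y x) / 2) - 1 / 2\<bar> \<le> \<delta>"
proof -
  let ?v = "normalized_indicator Y"
  let ?u = "convolution G (normalized_indicator X) ?v"
  have v: "?v \<in> ell1 G" "ell1_norm G ?v = 1" using normalized_indicator_ell1[OF Y] by auto
  have u: "?u \<in> ell1 G" using convolution_ell1(1)[OF normalized_indicator_ell1(1)[OF X] v(1)] .
  have min: "(\<lambda>x. min (?u x) (?v x) / 2) \<in> ell1 G"
    by (rule ell1_half_dominated(1)[OF u v(1)]) auto
  have half: "(\<lambda>x. ?v x / 2) \<in> ell1 G"
    by (rule ell1_half_dominated(1)[OF v(1) v(1)]) auto
  have "ell1_norm G (\<lambda>x. ?v x / 2) = 1 / 2"
    using v(2) infsum_cmult_left'[of "\<lambda>x. \<bar>?v x\<bar>" "1 / 2" "carrier G"]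
    by (simp add: ell1_norm_def)
  then have "\<bar>ell1_norm G (\<lambda>x. min (?u x) (?v x) / 2) - 1 / 2\<bar>
      \<le> ell1_norm G (\<lambda>x. min (?u x) (?v x) / 2 - ?v x / 2)"
    using abs_ell1_norm_diff_le[OF min half] by simp
  \<comment> \<open>Pointwise, \<open>min ?u ?v\<close> differs from \<open>?v\<close> by at most
    \<open>\<bar>?u - ?v\<bar>\<close>. The distance occurs twice because
    \<open>ell1_half_dominated\<close> averages two functions, here taken equal.\<close>
  also have "\<dots> \<le> (ell1_dist G ?u ?v + ell1_dist G ?u ?v) / 2"
    by (rule ell1_half_dominated(2)[OF ell1_diff[OF u v(1)] ell1_diff[OF u v(1)]])
      (auto simp: min_def)
  also have "\<dots> \<le> \<delta>"
    using ell1_dist_convolution_normalized_indicator[OF X Y \<delta>] by simp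
  finally show ?thesis .
qed

text \<open>As the convolution is nonnegative, the meet vanishes off \<open>Y\<close>; on each of
  the \<open>card Y\<close> points of \<open>Y\<close> it is at most \<open>1 / card X\<close> by
  the uniform bound.\<close>

lemma meet_value_le_card_quotient:
  assumes X: "finite X" "X \<subseteq> carrier G" and Y: "finite Y" "Y \<subseteq> carrier G"
  shows "ell1_norm G (\<lambda>x. min (convolution G (normalized_indicator X) (normalized_indicator Y) x)
    (normalized_indicator Y x) / 2) \<le> real (card Y) / real (card X)"
proof -
  let ?v = "normalized_indicator Y"
  let ?u = "convolution G (normalized_indicator X) ?v"
  note bounds = convolution_normalized_indicator_bounds[OF X Y(1)]
  have v: "0 \<le> ?v x" for x by (simp add: normalized_indicator_def)
  have "ell1_norm G (\<lambda>x. min (?u x) (?v x) / 2) = (\<Sum>x\<in>Y. \<bar>min (?u x) (?v x) / 2\<bar>)"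
    by (rule ell1_finite_support(2)[OF Y])
      (use bounds(1) in \<open>simp add: normalized_indicator_def min_def order_antisym\<close>)
  also have "\<dots> \<le> (\<Sum>x\<in>Y. 1 / real (card X))"
  proof (rule sum_mono)
    fix x
    show "\<bar>min (?u x) (?v x) / 2\<bar> \<le> 1 / real (card X)"
      using bounds[of x] v[of x] by (simp add: min_def)
  qed
  finally show ?thesis by simp
qed

end

theorem proposition4p2:
  fixes G :: "('g, 'b) monoid_scheme"
  assumes "group G"
    and "infinite (carrier G)"
    and "amenable G"
  shows "unstable TYPE('g \<Rightarrow> real) L_cnv (Th L_cnv (ell1_cnv G))"
proof -
  interpret group G by (rule assms(1))
  obtain X where X: "\<And>n. finite (X n)" "\<And>n. X n \<noteq> {}" "\<And>n. X n \<subseteq> carrier G"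
    "\<And>n. n \<le> card (X n)"
    and inv: "\<And>n m g. n \<le> m \<Longrightarrow> g \<in> X n \<Longrightarrow>
      real (card (sym_diff (g <#\<^bsub>G\<^esub> X (Suc m)) (X (Suc m))))
        \<le> 1 / real (Suc m) * real (card (X (Suc m)))"
    using almost_invariant_sequence_exists[OF assms(2,3)] by metis
  let ?a = "\<lambda>n. [normalized_indicator (X n)]"
  let ?F = "\<lambda>n m. fm_val (ell1_cnv G) (\<lambda>i. (?a n @ ?a m) ! i) meet_formula"
  have lim1: "(\<lambda>m. ?F n m) \<longlonglongrightarrow> 1 / 2" for n
  proof (rule LIMSEQ_imp_Suc, rule LIM_zero_cancel, rule Lim_null_comparison)
    \<comment> \<open>Invariance under \<open>X n\<close> is available for the sets with index
      \<open>Suc m\<close>, \<open>n \<le> m\<close>, so the limit is taken along the shifted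
      sequence.\<close>
    show "\<forall>\<^sub>F m in sequentially. norm (?F n (Suc m) - 1 / 2) \<le> 1 / real (Suc m)"
      using eventually_ge_at_top[of n]
    proof eventually_elim
      case (elim m)
      show ?case
        unfolding fm_val_meet_formula real_norm_def
        by (rule meet_value_almost_invariant) (use X inv[OF elim] in auto)
    qed
    show "(\<lambda>m. 1 / real (Suc m)) \<longlonglongrightarrow> 0"
      using LIMSEQ_inverse_real_of_nat by (simp add: inverse_eq_divide)
  qed
  have lim2: "(\<lambda>n. ?F n m) \<longlonglongrightarrow> 0" for m
  proof (rule Lim_null_comparison)
    show "\<forall>\<^sub>F n in sequentially. norm (?F n m) \<le> real (card (X m)) / real n"
      \<comment> \<open>Positivity of \<open>n\<close> lets the size bound
        \<open>n \<le> card (X n)\<close> be used in the denominator.\<close>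
      using eventually_gt_at_top[of 0]
    proof eventually_elim
      case (elim n)
      have "real (card (X m)) / real (card (X n)) \<le> real (card (X m)) / real n"
        using elim X(4)[of n] by (intro divide_left_mono) auto
      then show ?case
        unfolding fm_val_meet_formula
        using meet_value_le_card_quotient[OF X(1,3) X(1,3), of n m] by (simp add: ell1_norm_nonneg)
    qed
    show "(\<lambda>n. real (card (X m)) / real n) \<longlonglongrightarrow> 0" by (rule lim_const_over_n)
  qed
  \<comment> \<open>Neither inner limit depends on the remaining index, so both outer limits are
    those of constant sequences: \<open>1/2\<close> in one order, 0 in the other.\<close>
  have "iterated_limit ?F (1 / 2)"
    unfolding iterated_limit_def by (intro exI[of _ "\<lambda>_. 1 / 2"] conjI allI lim1 tendsto_const)
  moreover have "iterated_limit (\<lambda>m n. ?F n m) 0"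
    unfolding iterated_limit_def by (intro exI[of _ "\<lambda>_. 0"] conjI allI lim2 tendsto_const)
  moreover have "?a n \<in> tuples (ell1_cnv G) 1" for n
    using normalized_indicator_ell1[OF X(1-3), of n] by (simp add: tuples_ell1_1)
  moreover have "wf_fm L_cnv meet_formula" "free_vars meet_formula \<subseteq> {..<1 + 1}"
    by (auto simp: meet_formula_def)
  \<comment> \<open>By definition of \<open>Th\<close> a structure satisfies its own theory, so the
    parameters can be taken in \<open>ell1_cnv G\<close> itself.\<close>
  moreover have "model_of L_cnv (Th L_cnv (ell1_cnv G)) (ell1_cnv G)"
    by (simp add: model_of_def metric_structure_ell1_cnv Th_def)
  ultimately show ?thesis
    unfolding unstable_def
    by (intro exI[of _ "ell1_cnv G"] exI[of _ meet_formula] exI[of _ 1] exI[of _ ?a]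
        exI[of _ "1 / 2"] exI[of _ 0] conjI allI) simp_all
qed

end
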